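(* For every temporally connected temporal tree $\mathcal{T}$ (that is, every temporal graph $\mathcal{T}$ which is temporally connected and whose underlying static graph is a tree), there exists a Nash equilibrium in the two-player reverse temporal Voronoi game $\mathrm{rVor}(\mathcal{T},2)$.
   Context: A temporal graph $\mathcal{G}=(V,(E_t)_{t=1}^\infty)$ consists of a finite nonempty vertex set $V$ and an infinite sequence of edge sets $E_t\subseteq\binom{V}{2}$; it is assumed that the sequence is eventually constant (finite lifetime), i.e. there is $\tau$ with $E_t=E_\tau$ for all $t\ge\tau$. The underlying static graph is $(V,\bigcup_{t\ge1}E_t)$. A temporal tree is a temporal graph whose underlying graph is a tree. A temporal walk from $u$ to $v$ is a sequence $(\{v_0=u,v_1\},t_1),(\{v_1,v_2\},t_2),\dots,(\{v_{d-1},v_d=v\},t_d)$ with $t_i<t_{i+1}$ for all $i\in\{1,\dots,d-1\}$ (strictly increasing times) and $\{v_{i-1},v_i\}\in E_{t_i}$ for all $i\in\{1,\dots,d\}$; its arrival time is $t_d$. The temporal distance $\mathrm{td}(u,v)$ is the minimum arrival time of a temporal walk from $u$ to $v$, with $\mathrm{td}(u,u)=0$ and $\mathrm{td}(u,v)=\infty$ if there is no such walk. $\mathcal{G}$ is temporally connected if $\mathrm{td}(u,v)<\infty$ for all $u,v\in V$. In the two-player reverse temporal Voronoi game $\mathrm{rVor}(\mathcal{G},2)$, each player $i\in\{1,2\}$ selects one vertex $p_i\in V$ (equal choices are allowed). Player $i$ wins the set $U_i(p_1,p_2)=\{v\in V\mid \mathrm{td}(v,p_i)<\mathrm{td}(v,p_j)\}$,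 where $j\ne i$ is the other player, and her payoff is $u_i(p_1,p_2)=|U_i(p_1,p_2)|$. A profile $(p_1,p_2)\in V^2$ is a Nash equilibrium if $u_1(p',p_2)\le u_1(p_1,p_2)$ and $u_2(p_1,p')\le u_2(p_1,p_2)$ for all $p'\in V$. *)

theory Defs
  imports Main "HOL-Library.Extended_Nat"
begin

section \<open>Static graphs\<close>

definition graph_edges :: "'a set \<Rightarrow> 'a set set" where
  "graph_edges V = {e. e \<subseteq> V \<and> card e = 2}"

definition graph_connected :: "'a set \<Rightarrow> 'a set set \<Rightarrow> bool" where
  "graph_connected V F \<longleftrightarrow>
     (\<forall>u\<in>V. \<forall>v\<in>V. \<exists>vs. vs \<noteq> [] \<and> set vs \<subseteq> V \<and> hd vs = u \<and> last vs = v \<and>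
        successively (\<lambda>x y. {x, y} \<in> F) vs)"

text \<open>The closing edge joins the last vertex of the list back to the first one.\<close>

definition graph_cycle :: "'a set set \<Rightarrow> 'a list \<Rightarrow> bool" where
  "graph_cycle F vs \<longleftrightarrow>
     length vs \<ge> 3 \<and> distinct vs \<and>
     successively (\<lambda>x y. {x, y} \<in> F) vs \<and> {last vs, hd vs} \<in> F"

definition is_tree :: "'a set \<Rightarrow> 'a set set \<Rightarrow> bool" where
  "is_tree V F \<longleftrightarrow>
     V \<noteq> {} \<and> F \<subseteq> graph_edges V \<and> graph_connected V F \<and> (\<nexists>vs. graph_cycle F vs)"

section \<open>Temporal graphs\<close>

text \<open>
  Time steps are the integers from 1 on; the value \<open>E 0\<close> is irrelevant and
  is ignored by all the definitions below.
\<close>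

definition temporal_graph :: "'a set \<Rightarrow> (nat \<Rightarrow> 'a set set) \<Rightarrow> bool" where
  "temporal_graph V E \<longleftrightarrow>
     finite V \<and> V \<noteq> {} \<and> (\<forall>t\<ge>1. E t \<subseteq> graph_edges V) \<and>
     (\<exists>\<tau>\<ge>1. \<forall>t\<ge>\<tau>. E t = E \<tau>)"

definition underlying_edges :: "(nat \<Rightarrow> 'a set set) \<Rightarrow> 'a set set" where
  "underlying_edges E = (\<Union>t\<in>{1..}. E t)"

definition temporal_tree :: "'a set \<Rightarrow> (nat \<Rightarrow> 'a set set) \<Rightarrow> bool" where
  "temporal_tree V E \<longleftrightarrow> temporal_graph V E \<and> is_tree V (underlying_edges E)"

text \<open>
  A walk is the list of its pairs (edge, time); \<open>vs\<close> lists the vertices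
  \<open>v\<^sub>0, \<dots>, v\<^sub>d\<close> that it visits.
\<close>

definition temporal_walk ::
  "(nat \<Rightarrow> 'a set set) \<Rightarrow> 'a \<Rightarrow> 'a \<Rightarrow> ('a set \<times> nat) list \<Rightarrow> bool" where
  "temporal_walk E u v w \<longleftrightarrow>
     w \<noteq> [] \<and> sorted_wrt (<) (map snd w) \<and>
     (\<exists>vs. length vs = Suc (length w) \<and> hd vs = u \<and> last vs = v \<and>
        (\<forall>i<length w. fst (w ! i) = {vs ! i, vs ! Suc i} \<and>
           snd (w ! i) \<ge> 1 \<and> fst (w ! i) \<in> E (snd (w ! i))))"

definition arrival_time :: "('a set \<times> nat) list \<Rightarrow> nat" where
  "arrival_time w = snd (last w)"

text \<open>Infima in \<open>enat\<close> are minima, except that \<open>Inf {} = \<infinity>\<close>.\<close>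

definition td :: "(nat \<Rightarrow> 'a set set) \<Rightarrow> 'a \<Rightarrow> 'a \<Rightarrow> enat" where
  "td E u v = (if u = v then 0 else Inf {enat (arrival_time w) | w. temporal_walk E u v w})"

definition temporally_connected :: "'a set \<Rightarrow> (nat \<Rightarrow> 'a set set) \<Rightarrow> bool" where
  "temporally_connected V E \<longleftrightarrow> (\<forall>u\<in>V. \<forall>v\<in>V. td E u v < \<infinity>)"

section \<open>The two-player reverse temporal Voronoi game\<close>

text \<open>
  \<open>rvor_won V E p q\<close> is the set won by a player at \<open>p\<close> whose opponent is at \<open>q\<close>;
  distances are measured from the vertices towards the players.
\<close>

definition rvor_won :: "'a set \<Rightarrow> (nat \<Rightarrow> 'a set set) \<Rightarrow> 'a \<Rightarrow> 'a \<Rightarrow> 'a set" where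
  "rvor_won V E p q = {v \<in> V. td E v p < td E v q}"

definition rvor_payoff1 :: "'a set \<Rightarrow> (nat \<Rightarrow> 'a set set) \<Rightarrow> 'a \<Rightarrow> 'a \<Rightarrow> nat" where
  "rvor_payoff1 V E p\<^sub>1 p\<^sub>2 = card (rvor_won V E p\<^sub>1 p\<^sub>2)"

definition rvor_payoff2 :: "'a set \<Rightarrow> (nat \<Rightarrow> 'a set set) \<Rightarrow> 'a \<Rightarrow> 'a \<Rightarrow> nat" where
  "rvor_payoff2 V E p\<^sub>1 p\<^sub>2 = card (rvor_won V E p\<^sub>2 p\<^sub>1)"

definition rvor_nash :: "'a set \<Rightarrow> (nat \<Rightarrow> 'a set set) \<Rightarrow> 'a \<Rightarrow> 'a \<Rightarrow> bool" where
  "rvor_nash V E p\<^sub>1 p\<^sub>2 \<longleftrightarrow>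
     p\<^sub>1 \<in> V \<and> p\<^sub>2 \<in> V \<and>
     (\<forall>p'\<in>V. rvor_payoff1 V E p' p\<^sub>2 \<le> rvor_payoff1 V E p\<^sub>1 p\<^sub>2) \<and>
     (\<forall>p'\<in>V. rvor_payoff2 V E p\<^sub>1 p' \<le> rvor_payoff2 V E p\<^sub>1 p\<^sub>2)"

end

(*
  Deleting an edge {x, q} of the tree leaves two sides.  A temporal walk from the side of x to a
  vertex w on the side of q crosses the edge from x to q, so it visits x strictly before it
  arrives at w.  Hence against an opponent at q no position is better than a neighbour x of q,
  and such a neighbour wins exactly its side of the edge.  An edge {x, c} for which the smaller
  of the two sides is as large as possible is therefore an equilibrium.
*)
theory Submission
  imports Defs
begin

section \<open>Sides of an edge in a tree\<close>

text \<open>If the vertex to be prepended already lies on the path, the path is cut back to start at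
  that occurrence instead.\<close>

lemma rtranclp_imp_distinct_path:
  assumes "r\<^sup>*\<^sup>* x y"
  shows "\<exists>vs. vs \<noteq> [] \<and> distinct vs \<and> successively r vs \<and> hd vs = x \<and> last vs = y"
  using assms
proof (induction rule: converse_rtranclp_induct)
  case base
  show ?case by (rule exI[of _ "[y]"]) simp
next
  case (step a b)
  then obtain vs where vs: "vs \<noteq> []" "distinct vs" "successively r vs" "hd vs = b" "last vs = y"
    by blast
  show ?case
  proof (cases "a \<in> set vs")
    case True
    then obtain ys zs where "vs = ys @ a # zs" by (meson split_list)
    then show ?thesis
      using vs by (intro exI[of _ "a # zs"]) (auto simp: successively_append_iff)
  next
    case False
    then show ?thesis
      using vs step(1) by (intro exI[of _ "a # vs"]) (auto simp: successively_Cons)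
  qed
qed

lemma successively_imp_rtranclp:
  assumes "successively r vs" "vs \<noteq> []"
  shows "r\<^sup>*\<^sup>* (hd vs) (last vs)"
  using assms
  by (induction vs) (auto simp: successively_Cons intro: converse_rtranclp_into_rtranclp)

lemma graph_edgeD: "F \<subseteq> graph_edges V \<Longrightarrow> {a, b} \<in> F \<Longrightarrow> a \<in> V \<and> b \<in> V \<and> a \<noteq> b"
  by (auto simp: graph_edges_def card_2_iff doubleton_eq_iff)

text \<open>The connected component of \<open>x\<close> once the edge \<open>{x, q}\<close> is
  deleted. Comparing unordered pairs bars the edge in both directions.\<close>

definition side :: "'a set set \<Rightarrow> 'a \<Rightarrow> 'a \<Rightarrow> 'a set" where
  "side F x q = {v. (\<lambda>a b. {a, b} \<in> F \<and> {a, b} \<noteq> {x, q})\<^sup>*\<^sup>* v x}"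

lemma side_self [simp]: "x \<in> side F x q"
  by (simp add: side_def)

lemma side_step:
  "{a, b} \<in> F \<Longrightarrow> {a, b} \<noteq> {x, q} \<Longrightarrow> b \<in> side F x q \<Longrightarrow> a \<in> side F x q"
  unfolding side_def by (auto intro: converse_rtranclp_into_rtranclp)

lemma is_tree_reachable:
  assumes "is_tree V F" "u \<in> V" "v \<in> V"
  shows "(\<lambda>a b. {a, b} \<in> F)\<^sup>*\<^sup>* u v"
proof -
  obtain vs where "vs \<noteq> []" "hd vs = u" "last vs = v" "successively (\<lambda>x y. {x, y} \<in> F) vs"
    using assms unfolding is_tree_def graph_connected_def by meson
  then show ?thesis using successively_imp_rtranclp by fastforce
qed

lemma side_subset:
  assumes "is_tree V F" "{x, q} \<in> F"
  shows "side F x q \<subseteq> V"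
proof
  have F: "F \<subseteq> graph_edges V" using assms by (simp add: is_tree_def)
  fix v assume "v \<in> side F x q"
  then have "(\<lambda>a b. {a, b} \<in> F \<and> {a, b} \<noteq> {x, q})\<^sup>*\<^sup>* v x" by (simp add: side_def)
  then show "v \<in> V"
    using graph_edgeD[OF F] assms(2) by (cases rule: converse_rtranclpE) blast+
qed

lemma side_cover:
  assumes "is_tree V F" "{x, q} \<in> F" "v \<in> V"
  shows "v \<in> side F x q \<or> v \<in> side F q x"
proof -
  have "x \<in> V" using side_subset[OF assms(1,2)] by auto
  from is_tree_reachable[OF assms(1,3) this] show ?thesis
  proof (induction rule: converse_rtranclp_induct)
    case (step a b)
    show ?case
    proof (cases "{a, b} = {x, q}")
      case True
      then have "a = x \<or> a = q" by (auto simp: doubleton_eq_iff)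
      then show ?thesis by auto
    next
      case False
      then show ?thesis using step side_step[of a b F] by (metis insert_commute)
    qed
  qed simp
qed

text \<open>A common vertex would yield a simple path from \<open>x\<close> to \<open>q\<close>
  avoiding the edge, and the edge would close it to a cycle.\<close>

lemma side_disjoint:
  assumes T: "is_tree V F" and e: "{x, q} \<in> F"
  shows "side F x q \<inter> side F q x = {}"
proof (rule ccontr)
  let ?r = "\<lambda>a b. {a, b} \<in> F \<and> {a, b} \<noteq> {x, q}"
  assume "\<not> ?thesis"
  then obtain v where v: "?r\<^sup>*\<^sup>* v x" "?r\<^sup>*\<^sup>* v q"
    by (auto simp: side_def insert_commute)
  have "symp ?r" by (auto simp: symp_def insert_commute)
  then have "?r\<^sup>*\<^sup>* x v" using v(1) by (meson symp_rtranclp sympD)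
  then have "?r\<^sup>*\<^sup>* x q" using v(2) by (rule rtranclp_trans)
  from rtranclp_imp_distinct_path[OF this]
  obtain vs where vs: "vs \<noteq> []" "distinct vs" "successively ?r vs" "hd vs = x" "last vs = q"
    by (elim exE conjE)
  have "x \<noteq> q" using e T graph_edgeD[of F V x q] by (auto simp: is_tree_def)
  then obtain y zs where "vs = x # y # zs" using vs by (cases vs; cases "tl vs") auto
  \<comment> \<open>An empty \<open>zs\<close> would mean \<open>y = q\<close>, so that the first
    step is the forbidden edge.\<close>
  then have "length vs \<ge> 3" using vs by (cases zs) auto
  moreover have "successively (\<lambda>a b. {a, b} \<in> F) vs"
    using vs(3) by (rule successively_mono) auto
  ultimately have "graph_cycle F vs"
    using vs e by (auto simp: graph_cycle_def insert_commute)
  then show False using T by (auto simp: is_tree_def)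
qed

text \<open>Take the penultimate vertex of a simple path from \<open>p\<close> to \<open>q\<close>:
  what precedes it avoids \<open>q\<close>, hence also the last edge.\<close>

lemma neighbour_towards:
  assumes "is_tree V F" "p \<in> V" "q \<in> V" "p \<noteq> q"
  obtains x where "{x, q} \<in> F" "p \<in> side F x q"
proof -
  obtain vs where vs: "vs \<noteq> []" "distinct vs" "successively (\<lambda>a b. {a, b} \<in> F) vs"
      "hd vs = p" "last vs = q"
    using rtranclp_imp_distinct_path[OF is_tree_reachable[OF assms(1-3)]] by blast
  define us where "us = butlast vs"
  have vs_eq: "vs = us @ [q]" using vs us_def by (metis append_butlast_last_id)
  have us: "us \<noteq> []" using vs vs_eq assms(4) by auto
  have "successively (\<lambda>a b. {a, b} \<in> F \<and> {a, b} \<noteq> {last us, q}) us"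
  proof (rule successively_mono)
    show "successively (\<lambda>a b. {a, b} \<in> F) us"
      using vs(3) by (simp add: vs_eq successively_append_iff)
    have "q \<notin> set us" using vs(2) by (simp add: vs_eq)
    then show "{a, b} \<in> F \<and> {a, b} \<noteq> {last us, q}"
      if "a \<in> set us" "b \<in> set us" "{a, b} \<in> F" for a b
      using that by (auto simp: doubleton_eq_iff)
  qed
  from successively_imp_rtranclp[OF this us] have "p \<in> side F (last us) q"
    using vs(4) us by (simp add: side_def vs_eq)
  moreover have "{last us, q} \<in> F"
    using vs(3) us by (simp add: vs_eq successively_append_iff)
  ultimately show ?thesis using that by blast
qed

section \<open>Temporal walks crossing an edge\<close>

lemma td_le_arrival:
  "temporal_walk E u v w \<Longrightarrow> td E u v \<le> enat (arrival_time w)"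
  unfolding td_def by (auto intro: Inf_lower)

text \<open>Finiteness excludes \<open>Inf {}\<close>, and an infimum of a nonempty set in
  \<open>enat\<close> is a least element. For \<open>u = v\<close> the distance 0 is a convention
  that no walk realises.\<close>

lemma td_attained:
  assumes "td E u v < \<infinity>" "u \<noteq> v"
  obtains w where "temporal_walk E u v w" "td E u v = enat (arrival_time w)"
proof -
  let ?A = "{enat (arrival_time w) | w. temporal_walk E u v w}"
  have td: "td E u v = Inf ?A" using assms(2) by (simp add: td_def)
  then have "?A \<noteq> {}" using assms(1) by (metis Inf_enat_def less_irrefl)
  then have "Inf ?A \<in> ?A" unfolding Inf_enat_def by (auto intro: LeastI)
  then show ?thesis using that td by auto
qed

text \<open>The body of \<open>temporal_walk\<close> is spelled out so that \<open>vs\<close> stays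
  fixed and its intermediate vertices can be named.\<close>

lemma temporal_walk_prefix:
  assumes "sorted_wrt (<) (map snd w)" "length vs = Suc (length w)"
    and "\<And>i. i < length w \<Longrightarrow> fst (w ! i) = {vs ! i, vs ! Suc i} \<and>
           snd (w ! i) \<ge> 1 \<and> fst (w ! i) \<in> E (snd (w ! i))"
    and "i < length w"
  shows "temporal_walk E (hd vs) (vs ! Suc i) (take (Suc i) w)"
proof -
  have "last (take (Suc (Suc i)) vs) = vs ! Suc i"
    using assms(2,4) by (simp add: take_Suc_conv_app_nth)
  moreover have "\<forall>j<length (take (Suc i) w). fst (take (Suc i) w ! j) =
        {take (Suc (Suc i)) vs ! j, take (Suc (Suc i)) vs ! Suc j} \<and>
      snd (take (Suc i) w ! j) \<ge> 1 \<and> fst (take (Suc i) w ! j) \<in> E (snd (take (Suc i) w ! j))"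
    using assms(3) by simp metis
  moreover have "sorted_wrt (<) (map snd (take (Suc i) w))"
    using assms(1) by (simp add: take_map[symmetric] sorted_wrt_take)
  moreover have "take (Suc i) w \<noteq> []" using assms(4) by auto
  ultimately show ?thesis
    unfolding temporal_walk_def using assms(2,4)
    by (intro conjI exI[of _ "take (Suc (Suc i)) vs"]) (assumption | simp)+
qed

lemma td_crossing:
  assumes T: "is_tree V (underlying_edges E)" and e: "{x, q} \<in> underlying_edges E"
    and v: "v \<in> side (underlying_edges E) x q" and z: "z \<in> side (underlying_edges E) q x"
    and fin: "td E v z < \<infinity>"
  shows "td E v x < td E v z" "td E v q \<le> td E v z"
proof -
  let ?S = "side (underlying_edges E) x q"
  have zS: "z \<notin> ?S" and qS: "q \<notin> ?S" using side_disjoint[OF T e] z by auto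
  then have "v \<noteq> z" using v by auto
  with fin obtain w where w: "temporal_walk E v z w" and td: "td E v z = enat (arrival_time w)"
    by (rule td_attained)
  then obtain vs where vs: "length vs = Suc (length w)" "hd vs = v" "last vs = z"
    and st: "\<And>i. i < length w \<Longrightarrow> fst (w ! i) = {vs ! i, vs ! Suc i} \<and>
           snd (w ! i) \<ge> 1 \<and> fst (w ! i) \<in> E (snd (w ! i))"
    and so: "sorted_wrt (<) (map snd w)" and ne: "w \<noteq> []"
    unfolding temporal_walk_def by blast
  have vs0: "vs ! 0 = v" using vs by (metis hd_conv_nth length_0_conv nat.simps(3))
  have vsl: "vs ! length w = z" using vs by (metis diff_Suc_1 last_conv_nth length_0_conv nat.simps(3))
  have "\<exists>i<length w. vs ! i \<in> ?S \<and> vs ! Suc i \<notin> ?S"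
  proof (rule ccontr)
    assume *: "\<not> ?thesis"
    have "i \<le> length w \<Longrightarrow> vs ! i \<in> ?S" for i
      by (induction i) (use * v vs0 in auto)
    then show False using vsl zS by auto
  qed
  then obtain i where i: "i < length w" "vs ! i \<in> ?S" "vs ! Suc i \<notin> ?S" by blast
  \<comment> \<open>By \<open>side_step\<close>, the only edge leading out of the side is the
    deleted one; as \<open>q\<close> lies outside, it is traversed from \<open>x\<close> to
    \<open>q\<close>.\<close>
  have "{vs ! Suc i, vs ! i} \<in> underlying_edges E"
    using st[OF i(1)] unfolding underlying_edges_def by (metis UN_I atLeast_iff insert_commute)
  from side_step[OF this _ i(2)] have "{vs ! Suc i, vs ! i} = {x, q}"
    using i(3) by blast
  then have xi: "vs ! i = x" and qi: "vs ! Suc i = q"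
    using i(2,3) qS by (auto simp: doubleton_eq_iff)
  have pre: "td E v (vs ! Suc j) \<le> enat (snd (w ! j))" if "j < length w" for j
  proof -
    have "arrival_time (take (Suc j) w) = snd (w ! j)"
      using that by (simp add: arrival_time_def take_Suc_conv_app_nth)
    then show ?thesis
      using td_le_arrival[OF temporal_walk_prefix[OF so vs(1) st that]] vs(2) by simp
  qed
  have mono: "snd (w ! j) < snd (w ! k)" if "j < k" "k < length w" for j k
    using so that by (auto simp: sorted_wrt_iff_nth_less)
  have "snd (w ! i) \<le> arrival_time w"
    using mono[of i "length w - 1"] i(1) ne
    by (cases "i = length w - 1") (fastforce simp: arrival_time_def last_conv_nth)+
  then have arr: "enat (snd (w ! i)) \<le> td E v z" by (simp add: td)
  show "td E v q \<le> td E v z" using pre[OF i(1)] qi arr by auto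
  have "td E v x < enat (snd (w ! i))"
  proof (cases i)
    \<comment> \<open>The walk starts at \<open>x\<close>, at distance 0, while every time label is
      at least 1. Otherwise the preceding label bounds the distance to \<open>x\<close>.\<close>
    case 0
    then have "td E v x = 0" using xi vs0 by (simp add: td_def)
    then show ?thesis using st[OF i(1)] by (simp add: zero_enat_def)
  next
    case (Suc j)
    have "td E v x \<le> enat (snd (w ! j))" using pre[of j] Suc xi i(1) by simp
    also have "\<dots> < enat (snd (w ! i))" using mono[of j i] Suc i(1) by simp
    finally show ?thesis .
  qed
  then show "td E v x < td E v z" using arr by (rule less_le_trans)
qed

section \<open>The game on a temporally connected tree\<close>

context
  fixes V :: "'a set" and E :: "nat \<Rightarrow> 'a set set" and F
  assumes tt: "temporal_tree V E" and tc: "temporally_connected V E"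
  defines "F \<equiv> underlying_edges E"
begin

lemma tree: "is_tree V F"
  using tt by (simp add: temporal_tree_def F_def)

lemma crossing:
  assumes "{x, q} \<in> F" "v \<in> side F x q" "z \<in> side F q x"
  shows "td E v x < td E v z" "td E v q \<le> td E v z"
proof -
  have "{q, x} \<in> F" using assms(1) by (simp add: insert_commute)
  then have "v \<in> V" "z \<in> V"
    using assms side_subset[OF tree] by blast+
  then have "td E v z < \<infinity>" using tc by (auto simp: temporally_connected_def)
  from td_crossing[OF tree[unfolded F_def] assms[unfolded F_def] this]
  show "td E v x < td E v z" "td E v q \<le> td E v z" by simp_all
qed

lemma rvor_won_neighbour:
  assumes "{x, q} \<in> F"
  shows "rvor_won V E x q = side F x q"
proof
  have "{q, x} \<in> F" using assms by (simp add: insert_commute)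
  then show "rvor_won V E x q \<subseteq> side F x q"
    using side_cover[OF tree assms] crossing(1)[of q x _ x]
    by (fastforce simp: rvor_won_def)
  show "side F x q \<subseteq> rvor_won V E x q"
    using side_subset[OF tree assms] crossing(1)[OF assms, of _ q]
    by (auto simp: rvor_won_def)
qed

text \<open>With \<open>x\<close> the neighbour of \<open>q\<close> towards \<open>p\<close>, every
  vertex on the side of \<open>q\<close> has to pass \<open>q\<close> before it reaches
  \<open>p\<close>.\<close>

lemma rvor_won_subset_side:
  assumes "p \<in> V" "q \<in> V" "p \<noteq> q"
  shows "\<exists>x. {x, q} \<in> F \<and> rvor_won V E p q \<subseteq> side F x q"
proof -
  obtain x where x: "{x, q} \<in> F" "p \<in> side F x q"
    using neighbour_towards[OF tree assms] .
  then have "{q, x} \<in> F" by (simp add: insert_commute)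
  then have "rvor_won V E p q \<subseteq> side F x q"
    using side_cover[OF tree x(1)] crossing(1)[of q x _ p] x(2)
    by (fastforce simp: rvor_won_def)
  then show ?thesis using x by blast
qed

text \<open>A static fact obtained from distances: a vertex beyond both \<open>x\<close> and
  \<open>y\<close> would reach \<open>x\<close> before \<open>c\<close> by the first edge, but
  \<open>c\<close> no later than \<open>x\<close> by the second. The inclusion is strict because of
  \<open>c\<close>.\<close>

lemma side_psubset:
  assumes "{y, c} \<in> F" "{x, c} \<in> F" "x \<noteq> y"
  shows "side F y c \<subset> side F c x"
proof -
  have "{y, c} \<noteq> {c, x}" "{x, c} \<noteq> {c, y}" using assms(3) by (auto simp: doubleton_eq_iff)
  then have xs: "x \<in> side F c y"
    using assms side_step[of x c F c y] by simp
  have "v \<in> side F c x" if v: "v \<in> side F y c" for v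
  proof (rule ccontr)
    assume "v \<notin> side F c x"
    then have "v \<in> side F x c"
      using side_cover[OF tree assms(2)] v side_subset[OF tree assms(1)] by blast
    then have "td E v x < td E v c" using crossing(1)[OF assms(2)] by simp
    moreover have "td E v c \<le> td E v x" using crossing(2)[OF assms(1) v xs] .
    ultimately show False by simp
  qed
  moreover have "c \<notin> side F y c" using side_disjoint[OF tree assms(1)] by auto
  ultimately show ?thesis by (metis psubsetI side_self subsetI)
qed

lemma ex_rvor_nash: "\<exists>p\<^sub>1 p\<^sub>2. rvor_nash V E p\<^sub>1 p\<^sub>2"
proof (cases "\<exists>p\<in>V. \<exists>q\<in>V. p \<noteq> q")
  case False
  have "V \<noteq> {}" using tree by (simp add: is_tree_def)
  then obtain p where "V = {p}" using False by blast
  then show ?thesis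
    by (intro exI[of _ p]) (auto simp: rvor_nash_def)
next
  case True
  have fV: "finite V" using tt by (simp add: temporal_tree_def temporal_graph_def)
  have FV: "a \<in> V \<and> b \<in> V" if "{a, b} \<in> F" for a b
    using graph_edgeD[of F V a b] tree that by (auto simp: is_tree_def)
  have fS: "finite (side F x q)" if "{x, q} \<in> F" for x q
    using side_subset[OF tree that] fV by (rule finite_subset)
  \<comment> \<open>Each edge occurs in \<open>?P\<close> in both orientations, and
    \<open>?m\<close> does not depend on the orientation. The optimal edge is later oriented so that
    \<open>x\<close> has the smaller side.\<close>
  let ?m = "\<lambda>(x, q). min (card (side F x q)) (card (side F q x))"
  let ?P = "{(x, q). {x, q} \<in> F}"
  have "?P \<subseteq> V \<times> V" using FV by auto
  then have "finite ?P" using fV by (meson finite_SigmaI finite_subset)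
  moreover have "?P \<noteq> {}" using True neighbour_towards[OF tree] by blast
  ultimately have "Max (?m ` ?P) \<in> ?m ` ?P" "\<And>f. f \<in> ?P \<Longrightarrow> ?m f \<le> Max (?m ` ?P)"
    by (simp_all only: Max_in Max_ge finite_imageI image_is_empty imageI not_False_eq_True)
  then obtain e where e: "e \<in> ?P" "\<And>f. f \<in> ?P \<Longrightarrow> ?m f \<le> ?m e"
    by (elim imageE) simp
  obtain x c where xc: "{x, c} \<in> F" and le: "card (side F x c) \<le> card (side F c x)"
    and mx: "\<And>y d. {y, d} \<in> F \<Longrightarrow>
      min (card (side F y d)) (card (side F d y)) \<le> card (side F x c)"
  proof -
    obtain a b where ab: "e = (a, b)" "{a, b} \<in> F" "{b, a} \<in> F"
      using e(1) by (auto simp: insert_commute)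
    have *: "\<And>y d. {y, d} \<in> F \<Longrightarrow>
      min (card (side F y d)) (card (side F d y)) \<le> min (card (side F a b)) (card (side F b a))"
      using e(2) ab(1) by fastforce
    show ?thesis
    proof (cases "card (side F a b) \<le> card (side F b a)")
      case True
      then show ?thesis using that[of a b] ab * by (simp add: min_def)
    next
      case False
      then show ?thesis using that[of b a] ab * by (simp add: min_def)
    qed
  qed
  have cx: "{c, x} \<in> F" using xc by (simp add: insert_commute)
  have 1: "card (side F y c) \<le> card (side F x c)" if y: "{y, c} \<in> F" for y
  proof (cases "y = x")
    case False
    have "{c, y} \<in> F" using y by (simp add: insert_commute)
    \<comment> \<open>The far side of the edge \<open>{y, c}\<close> exceeds the maximum of
      \<open>?m\<close>, so its other side must be the one that the maximum bounds.\<close>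
    then have "card (side F x c) < card (side F c y)"
      using side_psubset[OF xc y] False fS by (metis psubset_card_mono)
    then show ?thesis using mx[OF y] by simp
  qed simp
  have 2: "card (side F y x) \<le> card (side F c x)" if y: "{y, x} \<in> F" for y
  proof (cases "y = c")
    \<comment> \<open>Here the orientation decides: the side of \<open>y\<close> lies strictly
      inside that of \<open>x\<close>, the smaller of the two.\<close>
    case False
    then have "card (side F y x) < card (side F x c)"
      using side_psubset[OF y cx] fS[OF xc] by (metis psubset_card_mono)
    then show ?thesis using le by simp
  qed simp
  \<comment> \<open>Moving onto the opponent wins nothing, since ties count for nobody; any other
    position is bounded by a neighbour's side.\<close>
  have best: "card (rvor_won V E p q) \<le> n"
    if p: "p \<in> V" and q: "q \<in> V" and n: "\<And>y. {y, q} \<in> F \<Longrightarrow> card (side F y q) \<le> n" for p q n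
  proof (cases "p = q")
    case True
    then show ?thesis by (simp add: rvor_won_def)
  next
    case False
    then obtain y where "{y, q} \<in> F" "rvor_won V E p q \<subseteq> side F y q"
      using rvor_won_subset_side[OF p q] by blast
    then show ?thesis using n card_mono[OF fS] by (meson le_trans)
  qed
  have "rvor_nash V E x c"
    unfolding rvor_nash_def rvor_payoff1_def rvor_payoff2_def
      rvor_won_neighbour[OF xc] rvor_won_neighbour[OF cx]
    using FV[OF xc] best 1 2 by blast
  then show ?thesis by blast
qed

end

theorem theorem1:
  fixes V :: "'a set" and E :: "nat \<Rightarrow> 'a set set"
  assumes "temporal_tree V E"
    and "temporally_connected V E"
  shows "\<exists>p\<^sub>1 p\<^sub>2. rvor_nash V E p\<^sub>1 p\<^sub>2"
  using ex_rvor_nash[OF assms] .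

end
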